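(* Let $H$ be a finite group with identity $e$, let $S\subseteq H$ be a generating set with $e\notin S$ and $S=S^{-1}$, and let $G=\operatorname{Cay}(H,S)$. Then $G$ is DWR if and only if for every $1\le i\le\operatorname{diam}(G)$ and every $k\ge0$, $$S^k\cap\Gamma_i(e)=\Gamma_i(e)\quad\text{or}\quad S^k\cap\Gamma_i(e)=\emptyset.$$
   Context: The Cayley graph $\operatorname{Cay}(H,S)$ has vertex set $H$, with $x,y$ adjacent iff $yx^{-1}\in S$. $\Gamma_i(e)$ is the set of elements of $H$ at graph distance exactly $i$ from $e$. $S^k$ is the set of all products of $k$ elements of $S$ (with $S^0=\{e\}$). A connected graph is DWR (distance walk regular) if for all vertices $u,v$ and all $k\in\mathbb{N}$ the existence of a walk of length $k$ between $u$ and $v$ depends only on $k$ and $d(u,v)$. *)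

theory Defs
  imports
    "HOL-Algebra.Generated_Groups"
    "Graph_Theory.Digraph_Component"
    "Graph_Theory.Shortest_Path"
begin

text \<open>Undirected graphs are represented as symmetric digraphs, as in \<^locale>\<open>graph\<close>.
  Graph distance is the weighted distance of \<^theory>\<open>Graph_Theory.Shortest_Path\<close> for the
  constant weight 1; it is infinite between vertices that no walk joins.\<close>

definition graph_dist :: "('a, 'b) pre_digraph \<Rightarrow> 'a \<Rightarrow> 'a \<Rightarrow> ereal" where
  "graph_dist G u v = wf_digraph.\<mu> G (\<lambda>_. 1) u v"

definition graph_diam :: "('a, 'b) pre_digraph \<Rightarrow> ereal" where
  "graph_diam G = (SUP u \<in> verts G. SUP v \<in> verts G. graph_dist G u v)"

definition graph_sphere :: "('a, 'b) pre_digraph \<Rightarrow> nat \<Rightarrow> 'a \<Rightarrow> 'a set" where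
  "graph_sphere G i u = {v \<in> verts G. graph_dist G u v = ereal (real i)}"

definition has_walk :: "('a, 'b) pre_digraph \<Rightarrow> nat \<Rightarrow> 'a \<Rightarrow> 'a \<Rightarrow> bool" where
  "has_walk G k u v \<longleftrightarrow> (\<exists>p. pre_digraph.awalk G u p v \<and> length p = k)"

definition distance_walk_regular :: "('a, 'b) pre_digraph \<Rightarrow> bool" where
  "distance_walk_regular G \<longleftrightarrow> Digraph_Component.connected G \<and>
     (\<forall>u \<in> verts G. \<forall>v \<in> verts G. \<forall>u' \<in> verts G. \<forall>v' \<in> verts G. \<forall>k.
        graph_dist G u v = graph_dist G u' v' \<longrightarrow> (has_walk G k u v \<longleftrightarrow> has_walk G k u' v'))"

definition cayley_graph :: "('a, 'm) monoid_scheme \<Rightarrow> 'a set \<Rightarrow> ('a, 'a \<times> 'a) pre_digraph" where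
  "cayley_graph H S = with_proj
     \<lparr> pverts = carrier H,
       parcs = {(x, y). x \<in> carrier H \<and> y \<in> carrier H \<and> y \<otimes>\<^bsub>H\<^esub> inv\<^bsub>H\<^esub> x \<in> S} \<rparr>"

definition k_fold_products :: "('a, 'm) monoid_scheme \<Rightarrow> 'a set \<Rightarrow> nat \<Rightarrow> 'a set" where
  "k_fold_products H S k =
     {foldr (\<otimes>\<^bsub>H\<^esub>) xs \<one>\<^bsub>H\<^esub> | xs. set xs \<subseteq> S \<and> length xs = k}"

lemma graph_cayley_graph:
  assumes "Group.group H" and "finite (carrier H)" and "S \<subseteq> carrier H"
    and "\<one>\<^bsub>H\<^esub> \<notin> S" and "set_inv\<^bsub>H\<^esub> S = S"
  shows "graph (cayley_graph H S)"
proof -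
  interpret Group.group H by fact
  have "finite {(x, y). x \<in> carrier H \<and> y \<in> carrier H \<and> y \<otimes>\<^bsub>H\<^esub> inv\<^bsub>H\<^esub> x \<in> S}"
    by (rule finite_subset[OF _ finite_cartesian_product[OF assms(2) assms(2)]]) auto
  moreover have "x \<otimes>\<^bsub>H\<^esub> inv\<^bsub>H\<^esub> y \<in> S"
    if "x \<in> carrier H" "y \<in> carrier H" "y \<otimes>\<^bsub>H\<^esub> inv\<^bsub>H\<^esub> x \<in> S" for x y
  proof -
    have "inv\<^bsub>H\<^esub> (y \<otimes>\<^bsub>H\<^esub> inv\<^bsub>H\<^esub> x) = x \<otimes>\<^bsub>H\<^esub> inv\<^bsub>H\<^esub> y"
      using that by (simp add: inv_mult_group)
    moreover have "inv\<^bsub>H\<^esub> (y \<otimes>\<^bsub>H\<^esub> inv\<^bsub>H\<^esub> x) \<in> set_inv\<^bsub>H\<^esub> S"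
      using that unfolding SET_INV_def by blast
    ultimately show ?thesis using assms(5) by simp
  qed
  ultimately show ?thesis
    using assms(2,4) unfolding cayley_graph_def
    by unfold_locales (auto simp: symmetric_def sym_def arc_to_ends_def)
qed

end

theory Submission
  imports Defs
begin

text \<open>A walk of length \<open>k\<close> from \<open>u\<close> in the Cayley graph multiplies \<open>u\<close> on the left by \<open>k\<close>
  elements of \<open>S\<close>, one after the other, so a walk of length \<open>k\<close> joins \<open>u\<close> to \<open>v\<close> iff the quotient
  \<open>v u\<^sup>-\<^sup>1\<close> lies in \<open>S\<^sup>k\<close> (lemma \<open>has_walk_cayley_graph_iff\<close>). The distance is the least length of a
  walk, so it too depends only on the quotient (\<open>graph_dist_cayley_graph\<close>): it is the distance from
  the identity to \<open>v u\<^sup>-\<^sup>1\<close>. Distance walk regularity therefore says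
  exactly that membership in \<open>S\<^sup>k\<close> is constant on each sphere around the identity, that is, that
  \<open>S\<^sup>k\<close> contains the sphere or misses it.

  Three points remain to turn this into the theorem. All distances are finite, because a generating
  set closed under inverses reaches every element by plain products
  (\<open>generate_subset_k_fold_products\<close>). Distances do not exceed the diameter, so restricting the
  radius by the diameter excludes no pair of vertices. And the radius \<open>0\<close>, absent from the
  criterion, gives no condition, since the sphere of radius \<open>0\<close> is a single point.\<close>

section \<open>Distance and walk lengths\<close>

lemma graph_dist_eq_INF_has_walk:
  assumes "wf_digraph G"
  shows "graph_dist G u v = (INF k \<in> {k. has_walk G k u v}. ereal (real k))"
proof -
  interpret wf_digraph G by fact
  have cost: "awalk_cost (\<lambda>_. 1) p = real (length p)" for p
    by (induction p) simp_all
  have "{k. has_walk G k u v} = length ` {p. awalk u p v}"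
    by (auto simp: has_walk_def)
  then show ?thesis
    by (simp add: graph_dist_def \<mu>_def cost image_image)
qed

text \<open>The infimum that defines the distance ranges over natural numbers, so it is attained by the
  length of some walk.\<close>
lemma has_walk_imp_graph_dist_attained:
  assumes "wf_digraph G" and "has_walk G k u v"
  obtains i where "graph_dist G u v = ereal (real i)" and "has_walk G i u v"
proof -
  let ?i = "LEAST i. has_walk G i u v"
  have i: "has_walk G ?i u v"
    using assms(2) by (rule LeastI)
  have "graph_dist G u v = ereal (real ?i)"
    unfolding graph_dist_eq_INF_has_walk[OF assms(1)]
    by (rule INF_eqI) (use i in \<open>auto intro: Least_le\<close>)
  with i show thesis using that by blast
qed

lemma has_walk_0_iff:
  assumes "wf_digraph G"
  shows "has_walk G 0 u v \<longleftrightarrow> u = v \<and> u \<in> verts G"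
proof -
  interpret wf_digraph G by fact
  show ?thesis by (simp add: has_walk_def awalk_Nil_iff)
qed

lemma has_walk_Suc_iff:
  assumes "wf_digraph G"
  shows "has_walk G (Suc k) u v \<longleftrightarrow> (\<exists>e \<in> arcs G. tail G e = u \<and> has_walk G k (head G e) v)"
proof -
  interpret wf_digraph G by fact
  have "has_walk G (Suc k) u v \<longleftrightarrow> (\<exists>e p. awalk u (e # p) v \<and> length p = k)"
    unfolding has_walk_def length_Suc_conv by blast
  then show ?thesis
    unfolding awalk_Cons_iff has_walk_def by blast
qed

lemma graph_dist_le_diam:
  assumes "u \<in> verts G" and "v \<in> verts G"
  shows "graph_dist G u v \<le> graph_diam G"
  unfolding graph_diam_def using assms by (blast intro: SUP_upper2)

section \<open>Powers of a subset of a group\<close>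

lemma k_fold_products_0: "k_fold_products H S 0 = {\<one>\<^bsub>H\<^esub>}"
  by (auto simp: k_fold_products_def)

context Group.group
begin

lemma foldr_mult_closed: "set xs \<subseteq> carrier G \<Longrightarrow> foldr (\<otimes>) xs \<one> \<in> carrier G"
  by (induction xs) simp_all

lemma foldr_mult_append:
  "set xs \<subseteq> carrier G \<Longrightarrow> set ys \<subseteq> carrier G \<Longrightarrow>
   foldr (\<otimes>) (xs @ ys) \<one> = foldr (\<otimes>) xs \<one> \<otimes> foldr (\<otimes>) ys \<one>"
  by (induction xs) (simp_all add: foldr_mult_closed m_assoc)

lemma k_fold_products_closed:
  "S \<subseteq> carrier G \<Longrightarrow> k_fold_products G S k \<subseteq> carrier G"
  by (auto simp: k_fold_products_def intro!: foldr_mult_closed)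

lemma k_fold_products_1:
  assumes "S \<subseteq> carrier G"
  shows "k_fold_products G S (Suc 0) = S"
proof -
  have "foldr (\<otimes>) [s] \<one> = s" if "s \<in> S" for s using that assms by auto
  then show ?thesis
    by (force simp: k_fold_products_def length_Suc_conv)
qed

lemma k_fold_products_add:
  assumes "S \<subseteq> carrier G"
  shows "k_fold_products G S (j + k) = k_fold_products G S j <#> k_fold_products G S k"
proof (intro equalityI subsetI)
  fix x assume "x \<in> k_fold_products G S (j + k)"
  then obtain xs where xs: "set xs \<subseteq> S" "length xs = j + k" "x = foldr (\<otimes>) xs \<one>"
    by (auto simp: k_fold_products_def)
  have sub: "set (take j xs) \<subseteq> S" "set (drop j xs) \<subseteq> S"
    using xs(1) set_take_subset set_drop_subset by fast+
  have "x = foldr (\<otimes>) (take j xs) \<one> \<otimes> foldr (\<otimes>) (drop j xs) \<one>"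
    using foldr_mult_append[of "take j xs" "drop j xs"] sub assms xs(3) by simp
  moreover have "foldr (\<otimes>) (take j xs) \<one> \<in> k_fold_products G S j"
    "foldr (\<otimes>) (drop j xs) \<one> \<in> k_fold_products G S k"
    using sub xs(2) by (force simp: k_fold_products_def)+
  ultimately show "x \<in> k_fold_products G S j <#> k_fold_products G S k"
    by (auto simp: set_mult_def)
next
  fix x assume "x \<in> k_fold_products G S j <#> k_fold_products G S k"
  then obtain xs ys where "set xs \<subseteq> S" "length xs = j" "set ys \<subseteq> S" "length ys = k"
    and "x = foldr (\<otimes>) xs \<one> \<otimes> foldr (\<otimes>) ys \<one>"
    by (auto simp: set_mult_def k_fold_products_def)
  then have "x = foldr (\<otimes>) (xs @ ys) \<one>" "set (xs @ ys) \<subseteq> S" "length (xs @ ys) = j + k"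
    using assms foldr_mult_append[of xs ys] by auto
  then show "x \<in> k_fold_products G S (j + k)"
    unfolding k_fold_products_def by blast
qed

text \<open>The powers of \<open>S\<close> contain the identity and are closed under products. Inverses of generators
  are themselves generators when \<open>S\<close> is symmetric, so they add nothing beyond these products.\<close>
lemma generate_subset_k_fold_products:
  assumes "S \<subseteq> carrier G" and "set_inv S = S" and "x \<in> generate G S"
  shows "\<exists>k. x \<in> k_fold_products G S k"
  using assms(3)
proof (induction rule: generate.induct)
  case one
  have "\<one> \<in> k_fold_products G S 0" by (simp add: k_fold_products_0)
  then show ?case ..
next
  case (incl h)
  then show ?case using k_fold_products_1[OF assms(1)] by blast
next
  case (inv h)
  then have "inv h \<in> S" using assms(2) unfolding SET_INV_def by blast
  then show ?case using k_fold_products_1[OF assms(1)] by blast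
next
  case (eng h1 h2)
  then obtain j k where "h1 \<in> k_fold_products G S j" "h2 \<in> k_fold_products G S k"
    by blast
  then have "h1 \<otimes> h2 \<in> k_fold_products G S (j + k)"
    unfolding k_fold_products_add[OF assms(1)] by (auto simp: set_mult_def)
  then show ?case ..
qed

section \<open>Walks in Cayley graphs\<close>

lemma cayley_graph_simps:
  "verts (cayley_graph G S) = carrier G"
  "arcs (cayley_graph G S) = {(x, y). x \<in> carrier G \<and> y \<in> carrier G \<and> y \<otimes> inv x \<in> S}"
  "tail (cayley_graph G S) = fst" "head (cayley_graph G S) = snd"
  by (simp_all add: cayley_graph_def)

lemma wf_digraph_cayley_graph: "wf_digraph (cayley_graph G S)"
  by unfold_locales (auto simp: cayley_graph_simps)

text \<open>The first arc of a walk from \<open>u\<close> to \<open>v\<close> leads to \<open>s u\<close> with \<open>s \<in> S\<close>, and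
  \<open>v u\<^sup>-\<^sup>1 = (v (s u)\<^sup>-\<^sup>1) s\<close>. Removing that arc thus removes the rightmost factor of the product.\<close>
lemma has_walk_cayley_graph_iff:
  assumes "S \<subseteq> carrier G" and "u \<in> carrier G" and "v \<in> carrier G"
  shows "has_walk (cayley_graph G S) k u v \<longleftrightarrow> v \<otimes> inv u \<in> k_fold_products G S k"
  using assms(2)
proof (induction k arbitrary: u)
  case 0
  have "v \<otimes> inv u = \<one> \<longleftrightarrow> u = v"
    using 0 assms(3) by (metis inv_closed inv_equality inv_inv r_inv)
  then show ?case
    using 0 by (simp add: has_walk_0_iff[OF wf_digraph_cayley_graph] cayley_graph_simps k_fold_products_0)
next
  case (Suc k)
  have "has_walk (cayley_graph G S) (Suc k) u v \<longleftrightarrow>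
      (\<exists>w \<in> carrier G. w \<otimes> inv u \<in> S \<and> has_walk (cayley_graph G S) k w v)"
    using Suc.prems
    by (auto simp: has_walk_Suc_iff[OF wf_digraph_cayley_graph] cayley_graph_simps)
  also have "\<dots> \<longleftrightarrow>
      (\<exists>w \<in> carrier G. w \<otimes> inv u \<in> S \<and> v \<otimes> inv w \<in> k_fold_products G S k)"
    using Suc.IH by blast
  also have "\<dots> \<longleftrightarrow> (\<exists>p \<in> k_fold_products G S k. \<exists>s \<in> S. v \<otimes> inv u = p \<otimes> s)"
  proof (intro iffI; elim bexE conjE)
    fix w assume w: "w \<in> carrier G" "w \<otimes> inv u \<in> S" "v \<otimes> inv w \<in> k_fold_products G S k"
    have "v \<otimes> inv u = (v \<otimes> inv w) \<otimes> (w \<otimes> inv u)"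
      using w(1) Suc.prems assms(3) by (simp add: m_assoc inv_solve_left)
    with w show "\<exists>p \<in> k_fold_products G S k. \<exists>s \<in> S. v \<otimes> inv u = p \<otimes> s" by blast
  next
    fix p s assume ps: "p \<in> k_fold_products G S k" "s \<in> S" "v \<otimes> inv u = p \<otimes> s"
    have c: "p \<in> carrier G" "s \<in> carrier G"
      using ps k_fold_products_closed assms(1) by blast+
    have "(s \<otimes> u) \<otimes> inv u = s"
      using c Suc.prems by (simp add: m_assoc)
    moreover have "v \<otimes> inv (s \<otimes> u) = (v \<otimes> inv u) \<otimes> inv s"
      using c Suc.prems assms(3) by (simp add: inv_mult_group m_assoc)
    then have "v \<otimes> inv (s \<otimes> u) = p"
      using c ps(3) by (simp add: m_assoc)
    ultimately show "\<exists>w \<in> carrier G. w \<otimes> inv u \<in> S \<and> v \<otimes> inv w \<in> k_fold_products G S k"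
      using ps c Suc.prems by (intro bexI[of _ "s \<otimes> u"]) simp_all
  qed
  also have "\<dots> \<longleftrightarrow> v \<otimes> inv u \<in> k_fold_products G S (Suc k)"
    using k_fold_products_add[OF assms(1), of k "Suc 0"] k_fold_products_1[OF assms(1)]
    by (auto simp: set_mult_def)
  finally show ?case .
qed

lemma has_walk_from_one_iff:
  assumes "S \<subseteq> carrier G" and "x \<in> carrier G"
  shows "has_walk (cayley_graph G S) k \<one> x \<longleftrightarrow> x \<in> k_fold_products G S k"
  using has_walk_cayley_graph_iff[OF assms(1) one_closed assms(2)] assms(2) by simp

lemma graph_dist_cayley_graph:
  assumes "S \<subseteq> carrier G" and "u \<in> carrier G" and "v \<in> carrier G"
  shows "graph_dist (cayley_graph G S) u v = graph_dist (cayley_graph G S) \<one> (v \<otimes> inv u)"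
  unfolding graph_dist_eq_INF_has_walk[OF wf_digraph_cayley_graph]
  using assms by (simp add: has_walk_cayley_graph_iff)

lemma ex_walk_cayley_graph:
  assumes "S \<subseteq> carrier G" and "generate G S = carrier G" and "set_inv S = S"
    and "u \<in> carrier G" and "v \<in> carrier G"
  shows "\<exists>k. has_walk (cayley_graph G S) k u v"
  using generate_subset_k_fold_products[OF assms(1,3), of "v \<otimes> inv u"] assms
  by (simp add: has_walk_cayley_graph_iff)

lemma connected_cayley_graph:
  assumes "S \<subseteq> carrier G" and "generate G S = carrier G" and "set_inv S = S"
  shows "Digraph_Component.connected (cayley_graph G S)"
proof -
  interpret C: wf_digraph "cayley_graph G S" by (rule wf_digraph_cayley_graph)
  show ?thesis
  proof (rule C.connectedI)
    show "verts (cayley_graph G S) \<noteq> {}"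
      using one_closed by (auto simp: cayley_graph_simps)
    show "u \<rightarrow>\<^sup>*\<^bsub>mk_symmetric (cayley_graph G S)\<^esub> v"
      if "u \<in> verts (cayley_graph G S)" "v \<in> verts (cayley_graph G S)" for u v
    proof (rule C.reachable_mk_symmetricI)
      show "u \<rightarrow>\<^sup>*\<^bsub>cayley_graph G S\<^esub> v"
        using ex_walk_cayley_graph[OF assms, of u v] that
        by (simp add: cayley_graph_simps has_walk_def C.reachable_awalk)
    qed
  qed
qed

end

section \<open>Distance walk regularity of Cayley graphs\<close>

theorem theorem8p4:
  fixes H :: "('a, 'm) monoid_scheme" and S :: "'a set"
  assumes "Group.group H" and "finite (carrier H)"
    and "S \<subseteq> carrier H" and "generate H S = carrier H"
    and "\<one>\<^bsub>H\<^esub> \<notin> S" and "set_inv\<^bsub>H\<^esub> S = S"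
  defines "G \<equiv> cayley_graph H S"
  shows "distance_walk_regular G \<longleftrightarrow>
    (\<forall>i k :: nat. 1 \<le> i \<and> ereal (real i) \<le> graph_diam G \<longrightarrow>
       k_fold_products H S k \<inter> graph_sphere G i \<one>\<^bsub>H\<^esub> = graph_sphere G i \<one>\<^bsub>H\<^esub> \<or>
       k_fold_products H S k \<inter> graph_sphere G i \<one>\<^bsub>H\<^esub> = {})"
    (is "_ \<longleftrightarrow> ?spheres")
proof -
  interpret Group.group H by fact
  have wf: "wf_digraph G"
    unfolding G_def by (rule wf_digraph_cayley_graph)
  have verts: "verts G = carrier H"
    by (simp add: G_def cayley_graph_simps)
  have walk: "has_walk G k u v \<longleftrightarrow> v \<otimes>\<^bsub>H\<^esub> inv\<^bsub>H\<^esub> u \<in> k_fold_products H S k"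
    if "u \<in> carrier H" "v \<in> carrier H" for k u v
    using has_walk_cayley_graph_iff[OF assms(3) that] by (simp add: G_def)
  show ?thesis
  proof
    assume dwr: "distance_walk_regular G"
    have "x \<in> k_fold_products H S k \<longleftrightarrow> y \<in> k_fold_products H S k"
      if "x \<in> graph_sphere G i \<one>\<^bsub>H\<^esub>" "y \<in> graph_sphere G i \<one>\<^bsub>H\<^esub>" for i k x y
    proof -
      have "x \<in> carrier H" "y \<in> carrier H" "graph_dist G \<one>\<^bsub>H\<^esub> x = graph_dist G \<one>\<^bsub>H\<^esub> y"
        using that by (auto simp: graph_sphere_def verts)
      moreover from this have "has_walk G k \<one>\<^bsub>H\<^esub> x \<longleftrightarrow> has_walk G k \<one>\<^bsub>H\<^esub> y"
        using dwr one_closed unfolding distance_walk_regular_def verts by blast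
      ultimately show ?thesis
        using has_walk_from_one_iff[OF assms(3)] by (simp add: G_def)
    qed
    then show ?spheres by blast
  next
    assume spheres: ?spheres
    have "has_walk G k u v \<longleftrightarrow> has_walk G k u' v'"
      if uv: "u \<in> carrier H" "v \<in> carrier H" and uv': "u' \<in> carrier H" "v' \<in> carrier H"
        and dist: "graph_dist G u v = graph_dist G u' v'" for u v u' v' k
    proof -
      obtain m where "has_walk G m u v"
        using ex_walk_cayley_graph[OF assms(3,4,6) uv] unfolding G_def ..
      from has_walk_imp_graph_dist_attained[OF wf this]
      obtain i where i: "graph_dist G u v = ereal (real i)" "has_walk G i u v" .
      obtain m' where "has_walk G m' u' v'"
        using ex_walk_cayley_graph[OF assms(3,4,6) uv'] unfolding G_def ..
      from has_walk_imp_graph_dist_attained[OF wf this]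
      obtain i' where i': "graph_dist G u' v' = ereal (real i')" "has_walk G i' u' v'" .
      have ii': "i' = i" using i(1) i'(1) dist by simp
      show ?thesis
      proof (cases "i = 0")
        case True
        then have "u = v" "u' = v'"
          using i(2) i'(2) ii' by (auto simp: has_walk_0_iff[OF wf])
        then show ?thesis using uv uv' by (simp add: walk)
      next
        case False
        have "ereal (real i) \<le> graph_diam G"
          using graph_dist_le_diam[of u G v] uv i(1) by (simp add: verts)
        then have "k_fold_products H S k \<inter> graph_sphere G i \<one>\<^bsub>H\<^esub> = graph_sphere G i \<one>\<^bsub>H\<^esub> \<or>
            k_fold_products H S k \<inter> graph_sphere G i \<one>\<^bsub>H\<^esub> = {}"
          using spheres False by simp
        moreover have "v \<otimes>\<^bsub>H\<^esub> inv\<^bsub>H\<^esub> u \<in> graph_sphere G i \<one>\<^bsub>H\<^esub>"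
          "v' \<otimes>\<^bsub>H\<^esub> inv\<^bsub>H\<^esub> u' \<in> graph_sphere G i \<one>\<^bsub>H\<^esub>"
          using uv uv' i(1) i'(1) ii' graph_dist_cayley_graph[OF assms(3) uv]
            graph_dist_cayley_graph[OF assms(3) uv']
          by (simp_all add: graph_sphere_def G_def cayley_graph_simps)
        ultimately show ?thesis
          using uv uv' walk by blast
      qed
    qed
    moreover have "Digraph_Component.connected G"
      unfolding G_def using assms(3,4,6) by (rule connected_cayley_graph)
    ultimately show "distance_walk_regular G"
      unfolding distance_walk_regular_def verts by (intro conjI ballI allI impI)
  qed
qed

end
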